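(* Let $F=f+g$ on $\mathbb{R}^d$, where $f$ is convex and $L$-smooth and $g$ is proper, lower semicontinuous and convex, and let $F_*=\min F$. Suppose $F(x_0)-F_*\le \epsilon_0$ and that $F$ satisfies the Hölderian error bound (HEB) condition on the sublevel set $\mathcal{S}_{\epsilon_0}$ with parameters $\theta\in(0,1]$ and $0<c<\infty$. Let $\epsilon>0$. Then the iteration complexity of the proximal gradient method PG (returning the last iterate), started at $x_0$, for achieving $F(x_t)-F_*\le\epsilon$ is $$O\!\left(c^2L\,\epsilon_0^{2\theta-1}\right)\ \text{ if }\theta>1/2,\qquad O\!\left(\max\left\{\frac{c^2L}{\epsilon^{1-2\theta}},\ c^2L\log\left(\frac{\epsilon_0}{\epsilon}\right)\right\}\right)\ \text{ if }\theta\le 1/2.$$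
   Context: A function $f$ is $L$-smooth ($L>0$) if it is differentiable with $\|\nabla f(x)-\nabla f(y)\|_2\le L\|x-y\|_2$ for all $x,y$. The set of minimizers of $F$ is $\Omega_*$ (assumed nonempty), $F_*$ is the minimum value, $D(x,\Omega_* )=\min_{y\in\Omega_*}\|x-y\|_2$, and $\mathcal{S}_\xi=\{x\in\mathbb{R}^d: F(x)-F_*\le\xi\}$. HEB condition on $\mathcal{S}_\xi$ with parameters $\theta\in(0,1]$, $0<c<\infty$: $D(x,\Omega_* )\le c\,(F(x)-F_* )^\theta$ for all $x\in\mathcal{S}_\xi$. Proximal mapping: $P_{\eta g}(u)=\arg\min_{x}\frac12\|x-u\|_2^2+\eta g(x)$. PG: start from $x_1=x_0$ and for $\tau=1,\dots,t$ set $x_{\tau+1}=P_{g/L}(x_\tau-\nabla f(x_\tau)/L)$; the last iterate $x_{t+1}$ is returned. The iteration complexity is the number of iterations sufficient to reach the stated accuracy; $O(\cdot)$ hides a constant that may depend on $\theta$ but not on $c,L,\epsilon_0,\epsilon$ or the problem instance.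
   Formalization: The stated bound, false in general as no whole-iteration rounding is allowed, is proved when c²Lξ^{2θ-1} ≥ 1 at ξ = ε0 and ξ = ε; for θ = 1 it is proved as O(max{1, bound}); in all other cases as O(bound + 1 + log(ε0/ε)). *)

theory Defs
  imports "HOL-Analysis.Analysis"
begin

text \<open>
  The constant hidden in the complexity bound has to be uniform in the dimension \<open>d\<close>, so \<open>d\<close> must
  be an ordinary variable.  \<open>\<real>\<^sup>d\<close> is therefore the carrier of the library's \<^const>\<open>Euclidean_space\<close>:
  sequences vanishing from index \<open>d\<close> on.  Functions on \<open>\<real>\<^sup>d\<close> are only ever constrained there.
\<close>

abbreviation Rn :: "nat \<Rightarrow> (nat \<Rightarrow> real) set"
  where "Rn d \<equiv> topspace (Euclidean_space d)"

definition inner_n :: "nat \<Rightarrow> (nat \<Rightarrow> real) \<Rightarrow> (nat \<Rightarrow> real) \<Rightarrow> real"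
  where "inner_n d x y = (\<Sum>i<d. x i * y i)"

definition norm_n :: "nat \<Rightarrow> (nat \<Rightarrow> real) \<Rightarrow> real"
  where "norm_n d x = L2_set x {..<d}"

definition convex_fun :: "nat \<Rightarrow> ((nat \<Rightarrow> real) \<Rightarrow> ereal) \<Rightarrow> bool"
  where "convex_fun d h \<longleftrightarrow>
    (\<forall>x\<in>Rn d. \<forall>y\<in>Rn d. \<forall>u::real. 0 < u \<and> u < 1 \<longrightarrow>
       h (\<lambda>i. (1 - u) * x i + u * y i) \<le> ereal (1 - u) * h x + ereal u * h y)"

definition proper_fun :: "nat \<Rightarrow> ((nat \<Rightarrow> real) \<Rightarrow> ereal) \<Rightarrow> bool"
  where "proper_fun d h \<longleftrightarrow> (\<forall>x\<in>Rn d. h x \<noteq> -\<infinity>) \<and> (\<exists>x\<in>Rn d. h x \<noteq> \<infinity>)"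

definition lsc_fun :: "nat \<Rightarrow> ((nat \<Rightarrow> real) \<Rightarrow> ereal) \<Rightarrow> bool"
  where "lsc_fun d h \<longleftrightarrow> (\<forall>a. openin (Euclidean_space d) {x \<in> Rn d. a < h x})"

text \<open>Frechet differentiability on \<open>\<real>\<^sup>d\<close>, with the derivative represented by \<open>v\<close>.\<close>

definition has_gradient :: "nat \<Rightarrow> ((nat \<Rightarrow> real) \<Rightarrow> real) \<Rightarrow> (nat \<Rightarrow> real) \<Rightarrow> (nat \<Rightarrow> real) \<Rightarrow> bool"
  where "has_gradient d f x v \<longleftrightarrow> v \<in> Rn d \<and>
    (\<forall>e>0. \<exists>\<delta>>0. \<forall>y\<in>Rn d. norm_n d (y - x) < \<delta> \<longrightarrow>
       \<bar>f y - f x - inner_n d v (y - x)\<bar> \<le> e * norm_n d (y - x))"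

definition gradient :: "nat \<Rightarrow> ((nat \<Rightarrow> real) \<Rightarrow> real) \<Rightarrow> (nat \<Rightarrow> real) \<Rightarrow> (nat \<Rightarrow> real)"
  where "gradient d f x = (THE v. has_gradient d f x v)"

definition L_smooth :: "nat \<Rightarrow> real \<Rightarrow> ((nat \<Rightarrow> real) \<Rightarrow> real) \<Rightarrow> bool"
  where "L_smooth d L f \<longleftrightarrow> 0 < L \<and>
    (\<forall>x\<in>Rn d. \<exists>v. has_gradient d f x v) \<and>
    (\<forall>x\<in>Rn d. \<forall>y\<in>Rn d.
       norm_n d (gradient d f x - gradient d f y) \<le> L * norm_n d (x - y))"

definition objective :: "((nat \<Rightarrow> real) \<Rightarrow> real) \<Rightarrow> ((nat \<Rightarrow> real) \<Rightarrow> ereal) \<Rightarrow> (nat \<Rightarrow> real) \<Rightarrow> ereal"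
  where "objective f g x = ereal (f x) + g x"

definition minimizers :: "nat \<Rightarrow> ((nat \<Rightarrow> real) \<Rightarrow> ereal) \<Rightarrow> (nat \<Rightarrow> real) set"
  where "minimizers d F = {x. is_arg_min F (\<lambda>x. x \<in> Rn d) x}"

definition min_value :: "nat \<Rightarrow> ((nat \<Rightarrow> real) \<Rightarrow> ereal) \<Rightarrow> ereal"
  where "min_value d F = (INF x\<in>Rn d. F x)"

text \<open>The infimum is attained for the nonempty closed sets to which it is applied below.\<close>

definition dist_to :: "nat \<Rightarrow> (nat \<Rightarrow> real) \<Rightarrow> (nat \<Rightarrow> real) set \<Rightarrow> real"
  where "dist_to d x S = (INF y\<in>S. norm_n d (x - y))"

definition sublevel :: "nat \<Rightarrow> ((nat \<Rightarrow> real) \<Rightarrow> ereal) \<Rightarrow> real \<Rightarrow> (nat \<Rightarrow> real) set"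
  where "sublevel d F \<xi> = {x \<in> Rn d. F x - min_value d F \<le> ereal \<xi>}"

text \<open>
  On a sublevel set the gap \<open>F x - F\<^sub>*\<close> is a finite nonnegative number, so \<^const>\<open>real_of_ereal\<close> loses
  nothing.
\<close>

definition HEB :: "nat \<Rightarrow> ((nat \<Rightarrow> real) \<Rightarrow> ereal) \<Rightarrow> real \<Rightarrow> real \<Rightarrow> real \<Rightarrow> bool"
  where "HEB d F \<xi> \<theta> c \<longleftrightarrow>
    (\<forall>x\<in>sublevel d F \<xi>.
       dist_to d x (minimizers d F) \<le> c * real_of_ereal (F x - min_value d F) powr \<theta>)"

definition prox :: "nat \<Rightarrow> real \<Rightarrow> ((nat \<Rightarrow> real) \<Rightarrow> ereal) \<Rightarrow> (nat \<Rightarrow> real) \<Rightarrow> (nat \<Rightarrow> real)"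
  where "prox d \<eta> g u =
    arg_min (\<lambda>x. ereal ((norm_n d (x - u))\<^sup>2 / 2) + ereal \<eta> * g x) (\<lambda>x. x \<in> Rn d)"

text \<open>
  \<open>pg d L f g x\<^sub>0 t\<close> is the point returned after \<open>t\<close> iterations, i.e. \<open>x\<^sub>t\<^sub>+\<^sub>1\<close> when the starting point is
  counted as \<open>x\<^sub>1\<close>.
\<close>

primrec pg :: "nat \<Rightarrow> real \<Rightarrow> ((nat \<Rightarrow> real) \<Rightarrow> real) \<Rightarrow> ((nat \<Rightarrow> real) \<Rightarrow> ereal) \<Rightarrow>
    (nat \<Rightarrow> real) \<Rightarrow> nat \<Rightarrow> (nat \<Rightarrow> real)"
  where
    "pg d L f g x0 0 = x0"
  | "pg d L f g x0 (Suc t) =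
       prox d (1 / L) g (\<lambda>i. pg d L f g x0 t i - gradient d f (pg d L f g x0 t) i / L)"

definition pg_bound :: "real \<Rightarrow> real \<Rightarrow> real \<Rightarrow> real \<Rightarrow> real \<Rightarrow> real"
  where "pg_bound \<theta> c L \<epsilon>0 \<epsilon> =
    (if \<theta> > 1 / 2 then c\<^sup>2 * L * \<epsilon>0 powr (2 * \<theta> - 1)
     else max (c\<^sup>2 * L / \<epsilon> powr (1 - 2 * \<theta>)) (c\<^sup>2 * L * ln (\<epsilon>0 / \<epsilon>)))"

text \<open>
  Iterations come in whole numbers.  Halving a gap \<open>\<xi>\<close> costs \<open>\<lceil>c\<^sup>2 L \<xi>\<^bsup>2\<theta>-1\<^esup>\<rceil>\<close> iterations, and
  \<^const>\<open>pg_bound\<close> is the order of the sum of these costs with the ceilings dropped.  That is legitimate if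
  \<open>c\<^sup>2 L \<xi>\<^bsup>2\<theta>-1\<^esup> \<ge> 1\<close> throughout \<open>\<epsilon> \<le> \<xi> \<le> \<epsilon>\<^sub>0\<close>, and the quantity being monotone in \<open>\<xi>\<close> this is a condition
  on the two end points.  It always holds when \<open>g = 0\<close>, \<open>\<epsilon> \<le> \<epsilon>\<^sub>0\<close> and \<open>F\<close> is not constant, and in
  general it can be achieved by enlarging \<open>c\<close>, which preserves the error bound.
  For \<open>\<theta> < 1\<close> it cannot be omitted: with \<open>f = 0\<close>,
  \<open>g x = \<bar>x\<bar>\<^bsup>3/2\<^esup>\<close> on \<open>\<real>\<close> the hypotheses hold with \<open>\<theta> = 2/3\<close>, \<open>c = 1\<close> and \<open>L = x\<^sub>0 = \<epsilon>\<^sub>0 = 1\<close>, but no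
  iterate is a minimizer, so no number of iterations serves all \<open>\<epsilon> > 0\<close>.
\<close>

definition ceilings_negligible :: "real \<Rightarrow> real \<Rightarrow> real \<Rightarrow> real \<Rightarrow> real \<Rightarrow> bool"
  where "ceilings_negligible \<theta> c L \<epsilon>0 \<epsilon> \<longleftrightarrow>
    1 \<le> c\<^sup>2 * L * \<epsilon>0 powr (2 * \<theta> - 1) \<and> 1 \<le> c\<^sup>2 * L * \<epsilon> powr (2 * \<theta> - 1)"

end

theory Submission
  imports Defs
begin

text \<open>
  Write \<open>\<delta>\<^sub>t = F x\<^sub>t - F\<^sub>*\<close> for the gap after \<open>t\<close> iterations.  A proximal gradient step from \<open>x\<close> to \<open>p\<close>
  satisfies \<open>F p + L/2 \<parallel>u - p\<parallel>\<^sup>2 \<le> F u + L/2 \<parallel>u - x\<parallel>\<^sup>2\<close> for all \<open>u\<close> (\<open>gap_step\<close>).  So \<open>\<delta>\<close> is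
  nonincreasing, all iterates stay in the sublevel set on which the error bound holds, and summing over \<open>k\<close>
  steps with \<open>u\<close> a minimizer gives \<open>2 k \<delta>\<^sub>s\<^sub>+\<^sub>k \<le> L D(x\<^sub>s, \<Omega>\<^sub>*)\<^sup>2\<close>.  With the error bound this becomes
  \<open>2 k \<delta>\<^sub>s\<^sub>+\<^sub>k \<le> c\<^sup>2 L \<delta>\<^sub>s\<^bsup>2\<theta>\<^esup>\<close> (\<open>gap_rate\<close>), which plays the role of a restart at \<open>x\<^sub>s\<close>, although the
  algorithm never restarts: once the gap is at most \<open>\<xi>\<close>, another \<open>\<lceil>c\<^sup>2 L \<xi>\<^bsup>2\<theta>-1\<^esup>\<rceil>\<close> iterations bring it
  down to \<open>\<xi> / 2\<close> (\<open>halving_stages\<close>).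

  About \<open>log\<^sub>2 (\<epsilon>\<^sub>0 / \<epsilon>)\<close> such stages lead from \<open>\<epsilon>\<^sub>0\<close> to \<open>\<epsilon>\<close>.  Their costs, ceilings aside, form a
  geometric progression, and this is where the cases \<open>\<theta> > 1/2\<close> and \<open>\<theta> \<le> 1/2\<close> come from
  (\<open>sum_stage_costs_le\<close>).  The ceilings add at most one iteration per stage, which accounts for the summand
  \<open>1 + ln (\<epsilon>\<^sub>0 / \<epsilon>)\<close>, and at most double the sum if each stage costs at least one iteration
  (\<open>sum_stage_costs_ceiling_le\<close>).

  For \<open>\<theta> = 1\<close> the logarithm can be avoided because the method terminates.  The minimum is then sharp: in
  the sublevel set, but away from the minimizers, all subgradients of \<open>F\<close> have norm at least \<open>1 / c\<close>, whereas at \<open>p\<close> there is one of norm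
  at most \<open>2 L \<parallel>x - p\<parallel>\<close>.  So a step that does not reach a minimizer has length at least \<open>1 / (2 c L)\<close> and
  lowers the gap by at least \<open>1 / (8 c\<^sup>2 L)\<close> (\<open>sharp_gap_decrease\<close>), which can happen at most
  \<open>8 c\<^sup>2 L \<epsilon>\<^sub>0\<close> times.
\<close>

section \<open>Euclidean geometry on the carrier\<close>

lemma Rn_iff: "x \<in> Rn d \<longleftrightarrow> (\<forall>i\<ge>d. x i = 0)"
  by (simp add: topspace_Euclidean_space)

lemma Rn_diff: "x \<in> Rn d \<Longrightarrow> y \<in> Rn d \<Longrightarrow> x - y \<in> Rn d"
  by (simp add: Rn_iff)

lemma Rn_affine: "x \<in> Rn d \<Longrightarrow> y \<in> Rn d \<Longrightarrow> (\<lambda>i. a * x i + b * y i) \<in> Rn d"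
  by (simp add: Rn_iff)

lemma Rn_ray: "x \<in> Rn d \<Longrightarrow> h \<in> Rn d \<Longrightarrow> (\<lambda>i. x i + s * h i) \<in> Rn d"
  by (simp add: Rn_iff)

lemma norm_n_nonneg [simp]: "0 \<le> norm_n d x"
  by (simp add: norm_n_def)

lemma norm_n_sq: "(norm_n d x)\<^sup>2 = inner_n d x x"
  by (simp add: norm_n_def inner_n_def L2_set_def sum_nonneg power2_eq_square)

lemma norm_n_scale: "norm_n d (\<lambda>i. s * x i) = \<bar>s\<bar> * norm_n d x"
proof -
  have "(\<Sum>i<d. (s * x i)\<^sup>2) = s\<^sup>2 * (\<Sum>i<d. (x i)\<^sup>2)"
    by (simp add: power_mult_distrib sum_distrib_left)
  then show ?thesis
    by (simp add: norm_n_def L2_set_def real_sqrt_mult)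
qed

lemma norm_n_minus_commute: "norm_n d (x - y) = norm_n d (y - x)"
  by (simp add: norm_n_def L2_set_def power2_commute)

lemma coord_le_norm_n: "i < d \<Longrightarrow> \<bar>x i\<bar> \<le> norm_n d x"
  using member_le_L2_set[of "{..<d}" i "\<lambda>i. \<bar>x i\<bar>"]
  by (simp add: norm_n_def L2_set_def)

lemma inner_n_le_norm_n: "inner_n d x y \<le> norm_n d x * norm_n d y"
proof -
  have "inner_n d x y \<le> (\<Sum>i<d. \<bar>x i\<bar> * \<bar>y i\<bar>)"
    unfolding inner_n_def by (intro sum_mono) (metis abs_ge_self abs_mult)
  also have "\<dots> \<le> norm_n d x * norm_n d y"
    unfolding norm_n_def by (rule L2_set_mult_ineq)
  finally show ?thesis .
qed

lemma inner_n_scale_right: "inner_n d x (\<lambda>i. s * y i) = s * inner_n d x y"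
  by (simp add: inner_n_def sum_distrib_left algebra_simps)

lemma inner_n_diff_left: "inner_n d (x - y) z = inner_n d x z - inner_n d y z"
  by (simp add: inner_n_def sum_subtractf left_diff_distrib)

lemma inner_n_diff_right: "inner_n d x (y - z) = inner_n d x y - inner_n d x z"
  by (simp add: inner_n_def sum_subtractf right_diff_distrib)

lemma inner_n_commute: "inner_n d x y = inner_n d y x"
  by (simp add: inner_n_def mult.commute)

lemma norm_n_sq_ray:
  "(norm_n d ((\<lambda>i. x i + s * h i) - w))\<^sup>2
     = (norm_n d (x - w))\<^sup>2 + 2 * s * inner_n d (x - w) h + s\<^sup>2 * (norm_n d h)\<^sup>2"
  unfolding norm_n_sq
  by (simp add: inner_n_def sum_distrib_left sum.distrib[symmetric] power2_eq_square algebra_simps)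

lemma norm_n_sq_midpoint:
  "(norm_n d ((\<lambda>i. (1 - 1/2) * y i + 1/2 * z i) - w))\<^sup>2
     = (norm_n d (y - w))\<^sup>2 / 2 + (norm_n d (z - w))\<^sup>2 / 2 - (norm_n d (y - z))\<^sup>2 / 4"
  unfolding norm_n_sq inner_n_def sum_divide_distrib sum_subtractf[symmetric] sum.distrib[symmetric]
  by (intro sum.cong refl) (simp add: field_simps)

section \<open>Gradients of smooth convex functions\<close>

text \<open>
  Reducing to one variable along \<open>s \<mapsto> x + s h\<close> makes the library's mean value theorem and uniqueness of
  derivatives available for functions on \<open>\<real>\<^sup>d\<close>.
\<close>

lemma has_gradient_ray_derivative:
  assumes "has_gradient d f (\<lambda>i. x i + s * h i) v" and x: "x \<in> Rn d" and h: "h \<in> Rn d"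
  shows "((\<lambda>s. f (\<lambda>i. x i + s * h i)) has_real_derivative inner_n d v h) (at s)"
  unfolding DERIV_def LIM_eq
proof (intro allI impI)
  fix r :: real assume r: "0 < r"
  let ?p = "\<lambda>s i. x i + s * h i" and ?N = "norm_n d h + 1"
  have N: "0 < ?N" by (smt (verit) norm_n_nonneg)
  \<comment> \<open>The summand \<open>1\<close> in \<open>?N\<close> covers \<open>h = 0\<close>.\<close>
  then have "0 < r / (2 * ?N)" using r by simp
  then obtain \<delta> where \<delta>: "\<delta> > 0" and
    *: "\<And>y. y \<in> Rn d \<Longrightarrow> norm_n d (y - ?p s) < \<delta> \<Longrightarrow>
       \<bar>f y - f (?p s) - inner_n d v (y - ?p s)\<bar> \<le> r / (2 * ?N) * norm_n d (y - ?p s)"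
    using assms(1) unfolding has_gradient_def by meson
  show "\<exists>a>0. \<forall>k. k \<noteq> 0 \<and> norm (k - 0) < a \<longrightarrow>
        norm ((f (?p (s + k)) - f (?p s)) / k - inner_n d v h) < r"
  proof (intro exI conjI allI impI)
    show "0 < \<delta> / ?N" using \<delta> N by simp
    fix k :: real assume k: "k \<noteq> 0 \<and> norm (k - 0) < \<delta> / ?N"
    have diff: "?p (s + k) - ?p s = (\<lambda>i. k * h i)"
      by (auto simp: algebra_simps)
    have kN: "norm_n d (?p (s + k) - ?p s) = \<bar>k\<bar> * norm_n d h"
      unfolding diff by (rule norm_n_scale)
    have "\<bar>k\<bar> * norm_n d h \<le> \<bar>k\<bar> * ?N" by (simp add: mult_left_mono)
    also have "\<dots> < \<delta>" using k N by (simp add: pos_less_divide_eq)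
    finally have "\<bar>f (?p (s + k)) - f (?p s) - k * inner_n d v h\<bar> \<le> r / (2 * ?N) * (\<bar>k\<bar> * norm_n d h)"
      using *[OF Rn_ray[OF x h], of "s + k"] unfolding kN unfolding diff inner_n_scale_right by simp
    also have "\<dots> \<le> r / (2 * ?N) * (\<bar>k\<bar> * ?N)"
      using r N by (intro mult_left_mono) auto
    also have "\<dots> = r * \<bar>k\<bar> / 2" using less_imp_neq[OF N] by (simp add: divide_simps)
    also have "\<dots> < r * \<bar>k\<bar>" using r k by simp
    finally have "\<bar>f (?p (s + k)) - f (?p s) - k * inner_n d v h\<bar> / \<bar>k\<bar> < r"
      using k by (simp add: pos_divide_less_eq)
    then show "norm ((f (?p (s + k)) - f (?p s)) / k - inner_n d v h) < r"
      using k by (simp add: abs_divide[symmetric] diff_divide_distrib)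
  qed
qed

text \<open>
  Two gradients \<open>v\<close>, \<open>w\<close> give the same derivative in the direction \<open>v - w\<close>, so \<open>\<langle>v - w, v - w\<rangle> = 0\<close>.  This is
  what gives meaning to the definite description in \<^const>\<open>gradient\<close>.
\<close>

lemma has_gradient_unique:
  assumes v: "has_gradient d f x v" and w: "has_gradient d f x w" and x: "x \<in> Rn d"
  shows "v = w"
proof -
  have vw: "v \<in> Rn d" "w \<in> Rn d" using v w by (auto simp: has_gradient_def)
  let ?h = "v - w"
  have "((\<lambda>s. f (\<lambda>i. x i + s * ?h i)) has_real_derivative inner_n d v ?h) (at 0)"
       "((\<lambda>s. f (\<lambda>i. x i + s * ?h i)) has_real_derivative inner_n d w ?h) (at 0)"
    using v w by (auto intro!: has_gradient_ray_derivative x Rn_diff vw simp del: minus_apply)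
  then have "inner_n d v ?h = inner_n d w ?h" by (rule DERIV_unique)
  then have "(norm_n d ?h)\<^sup>2 = 0" unfolding norm_n_sq inner_n_diff_left by simp
  then have "\<And>i. i < d \<Longrightarrow> v i - w i = 0"
    using coord_le_norm_n[of _ d ?h] by simp
  moreover have "\<And>i. \<not> i < d \<Longrightarrow> v i - w i = 0" using vw by (simp add: Rn_iff)
  ultimately show ?thesis by (metis eq_iff_diff_eq_0 ext)
qed

lemma L_smooth_has_gradient:
  assumes "L_smooth d L f" "x \<in> Rn d"
  shows "has_gradient d f x (gradient d f x)"
proof -
  obtain v where v: "has_gradient d f x v" using assms by (auto simp: L_smooth_def)
  show ?thesis unfolding gradient_def
    by (rule theI[of "has_gradient d f x", OF v]) (rule has_gradient_unique[OF _ v assms(2)])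
qed

text \<open>
  By Cauchy-Schwarz and the Lipschitz bound, the derivative of \<open>s \<mapsto> f (x + s h)\<close> exceeds its value at
  \<open>0\<close> by at most \<open>L s \<parallel>h\<parallel>\<^sup>2\<close>; hence \<open>?\<psi>\<close>, the remainder of the quadratic upper model, is nonincreasing on
  \<open>[0, 1]\<close>.
\<close>

lemma descent_lemma:
  assumes sm: "L_smooth d L f" and x: "x \<in> Rn d" and y: "y \<in> Rn d"
  shows "f y \<le> f x + inner_n d (gradient d f x) (y - x) + L / 2 * (norm_n d (y - x))\<^sup>2"
proof -
  define h where "h = y - x"
  let ?p = "\<lambda>s i. x i + s * h i"
  let ?N = "norm_n d h"
  let ?\<psi> = "\<lambda>s. f (?p s) - s * inner_n d (gradient d f x) h - L / 2 * s\<^sup>2 * ?N\<^sup>2"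
  have h: "h \<in> Rn d" unfolding h_def using y x by (rule Rn_diff)
  have "?\<psi> 1 \<le> ?\<psi> 0"
  proof (rule DERIV_nonpos_imp_nonincreasing[where f = ?\<psi>])
    fix s :: real assume s: "0 \<le> s" "s \<le> 1"
    have "L * norm_n d (?p s - x) = L * s * ?N"
    proof -
      have "?p s - x = (\<lambda>i. s * h i)" by auto
      then show ?thesis using s by (simp add: norm_n_scale )
    qed
    then have lip: "norm_n d (gradient d f (?p s) - gradient d f x) \<le> L * s * ?N"
      using sm Rn_ray[OF x h] x unfolding L_smooth_def by metis
    have "inner_n d (gradient d f (?p s)) h - inner_n d (gradient d f x) h
        \<le> norm_n d (gradient d f (?p s) - gradient d f x) * ?N"
      using inner_n_le_norm_n[of d "gradient d f (?p s) - gradient d f x" h]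
      by (simp add: inner_n_diff_left)
    also have "\<dots> \<le> L * s * ?N * ?N" using lip by (intro mult_right_mono) auto
    finally have "inner_n d (gradient d f (?p s)) h - inner_n d (gradient d f x) h - L * s * ?N\<^sup>2 \<le> 0"
      by (simp add: power2_eq_square mult.assoc)
    moreover have "(?\<psi> has_real_derivative
        inner_n d (gradient d f (?p s)) h - inner_n d (gradient d f x) h - L * s * ?N\<^sup>2) (at s)"
      by (rule derivative_eq_intros has_gradient_ray_derivative L_smooth_has_gradient[OF sm]
          Rn_ray x h refl | simp)+
    ultimately show "\<exists>D. (?\<psi> has_real_derivative D) (at s) \<and> D \<le> 0" by blast
  qed simp
  moreover have "?p 1 = y" "?p 0 = x" by (auto simp: h_def)
  ultimately show ?thesis by (simp add: h_def)
qed

lemma le_of_le_add_small: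
  fixes a b K :: real
  assumes "\<And>s. 0 < s \<Longrightarrow> s < 1 \<Longrightarrow> a \<le> b + s * K"
  shows "a \<le> b"
proof (rule tendsto_lowerbound)
  show "((\<lambda>s. b + s * K) \<longlongrightarrow> b) (at_right 0)"
    by (auto intro!: tendsto_eq_intros)
  show "\<forall>\<^sub>F s in at_right 0. a \<le> b + s * K"
    using assms unfolding eventually_at_right_field by (intro exI[of _ 1]) auto
qed simp

text \<open>
  Convexity bounds the difference quotients of \<open>f\<close> along the segment from \<open>x\<close> to \<open>y\<close> by \<open>f y - f x\<close>; let the
  step tend to \<open>0\<close>.
\<close>

lemma convex_gradient_ineq:
  assumes sm: "L_smooth d L f" and cv: "convex_fun d (\<lambda>x. ereal (f x))"
    and x: "x \<in> Rn d" and y: "y \<in> Rn d"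
  shows "f x + inner_n d (gradient d f x) (y - x) \<le> f y"
proof -
  let ?h = "y - x" let ?p = "\<lambda>s i. x i + s * ?h i"
  have h: "?h \<in> Rn d" using x y by (rule Rn_diff[rotated])
  have "has_gradient d f (?p 0) (gradient d f x)"
    using L_smooth_has_gradient[OF sm x] by simp
  from has_gradient_ray_derivative[OF this x h]
  have D: "((\<lambda>k. (f (?p (0 + k)) - f (?p 0)) / k) \<longlongrightarrow> inner_n d (gradient d f x) ?h) (at_right 0)"
    unfolding DERIV_def using filterlim_at_split by blast
  have "inner_n d (gradient d f x) ?h \<le> f y - f x"
  proof (rule tendsto_upperbound[OF D])
    show "\<forall>\<^sub>F k in at_right 0. (f (?p (0 + k)) - f (?p 0)) / k \<le> f y - f x"
      unfolding eventually_at_right_field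
    proof (intro exI[of _ 1] conjI allI impI)
      fix k :: real assume k: "0 < k" "k < 1"
      have "(\<lambda>i. (1 - k) * x i + k * y i) = ?p k" by (auto simp: algebra_simps)
      with cv x y k have "f (?p k) \<le> (1 - k) * f x + k * f y"
        unfolding convex_fun_def by (metis plus_ereal.simps(1) times_ereal.simps(1) ereal_less_eq(3))
      then show "(f (?p (0 + k)) - f (?p 0)) / k \<le> f y - f x"
        using k by (simp add: pos_divide_le_eq right_diff_distrib left_diff_distrib mult.commute[of _ k])
    qed simp
  qed simp
  then show ?thesis by simp
qed

section \<open>The proximal mapping\<close>

text \<open>
  The topology of \<^const>\<open>Euclidean_space\<close> is that of coordinatewise convergence, so superlevel sets being
  open turns into the usual sequential form of lower semicontinuity.
\<close>

lemma lsc_fun_sequentially: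
  assumes "lsc_fun d g" and Y: "\<And>n. Y n \<in> Rn d" and z: "z \<in> Rn d"
    and lim: "\<And>i. (\<lambda>n. Y n i) \<longlonglongrightarrow> z i" and a: "a < g z"
  shows "\<forall>\<^sub>F n in sequentially. a < g (Y n)"
proof -
  have "limitin (Euclidean_space d) Y z sequentially"
    unfolding Euclidean_space_def limitin_subtopology
    using Y z lim by (auto simp: limitin_componentwise Rn_iff)
  moreover have "openin (Euclidean_space d) {x \<in> Rn d. a < g x}"
    using assms(1) by (simp add: lsc_fun_def)
  ultimately have "\<forall>\<^sub>F n in sequentially. Y n \<in> {x \<in> Rn d. a < g x}"
    using z a unfolding limitin_def by blast
  then show ?thesis by (rule eventually_mono) simp
qed

lemma norm_n_complete:
  assumes Y: "\<And>n. Y n \<in> Rn d"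
    and cauchy: "\<And>e. 0 < e \<Longrightarrow> \<exists>M. \<forall>m\<ge>M. \<forall>n\<ge>M. norm_n d (Y m - Y n) < e"
  shows "\<exists>z\<in>Rn d. \<forall>i. (\<lambda>n. Y n i) \<longlonglongrightarrow> z i"
proof -
  have "convergent (\<lambda>n. Y n i)" for i
  proof (cases "i < d")
    case True
    show ?thesis unfolding Cauchy_convergent_iff[symmetric] Cauchy_def
    proof (intro allI impI)
      fix e :: real assume "0 < e"
      then obtain M where "\<forall>m\<ge>M. \<forall>n\<ge>M. norm_n d (Y m - Y n) < e" using cauchy by blast
      then show "\<exists>M. \<forall>m\<ge>M. \<forall>n\<ge>M. dist (Y m i) (Y n i) < e"
        using coord_le_norm_n[OF True, of "Y _ - Y _"]
        by (metis dist_real_def minus_apply order_le_less_trans)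
    qed
  next
    case False
    then have "(\<lambda>n. Y n i) = (\<lambda>_. 0)" using Y by (auto simp: Rn_iff)
    then show ?thesis by (simp add: convergent_const)
  qed
  then obtain z where z: "\<And>i. (\<lambda>n. Y n i) \<longlonglongrightarrow> z i" unfolding convergent_def by metis
  moreover have "z \<in> Rn d" unfolding Rn_iff
  proof (intro allI impI)
    fix i assume "d \<le> i"
    then have "(\<lambda>n. Y n i) = (\<lambda>_. 0)" using Y by (auto simp: Rn_iff)
    with z[of i] show "z i = 0" by (simp add: LIMSEQ_const_iff)
  qed
  ultimately show ?thesis by blast
qed

lemma convex_fun_finite:
  assumes "convex_fun d g" "proper_fun d g" "y \<in> Rn d" "z \<in> Rn d"
    and "g y = ereal r" "g z = ereal r'" "0 < u" "u < 1"
  obtains q where "g (\<lambda>i. (1 - u) * y i + u * z i) = ereal q" "q \<le> (1 - u) * r + u * r'"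
proof -
  let ?m = "\<lambda>i. (1 - u) * y i + u * z i"
  have "g ?m \<le> ereal (1 - u) * g y + ereal u * g z"
    using assms unfolding convex_fun_def by blast
  then have le: "g ?m \<le> ereal ((1 - u) * r + u * r')" using assms by simp
  moreover have "g ?m \<noteq> -\<infinity>"
    using assms(2) Rn_affine[OF assms(3,4)] unfolding proper_fun_def by blast
  ultimately show ?thesis using that by (cases "g ?m") auto
qed

text \<open>
  \<^const>\<open>prox\<close> picks some minimizer, so its properties rest on a minimizer existing.  Half the squared
  distance is uniformly convex: the midpoint of two points that are almost optimal is better than their
  average by \<open>\<parallel>y - z\<parallel>\<^sup>2 / 8\<close>, and cannot beat the infimum \<open>m\<close>.  Hence a minimizing sequence is Cauchy, and lower
  semicontinuity passes the bound to its limit.  Boundedness from below is assumed because it is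
  immediate where the lemma is used; in general it follows from an affine minorant of \<open>g\<close>.
\<close>

lemma prox_is_arg_min:
  assumes \<eta>: "0 < \<eta>" and proper: "proper_fun d g" and lsc: "lsc_fun d g" and cv: "convex_fun d g"
    and bdd: "\<And>y r. y \<in> Rn d \<Longrightarrow> g y = ereal r \<Longrightarrow> b \<le> (norm_n d (y - w))\<^sup>2 / 2 + \<eta> * r"
  shows "is_arg_min (\<lambda>x. ereal ((norm_n d (x - w))\<^sup>2 / 2) + ereal \<eta> * g x) (\<lambda>x. x \<in> Rn d)
           (prox d \<eta> g w)"
proof -
  let ?\<Phi> = "\<lambda>x. ereal ((norm_n d (x - w))\<^sup>2 / 2) + ereal \<eta> * g x"
  let ?val = "\<lambda>y r. (norm_n d (y - w))\<^sup>2 / 2 + \<eta> * r"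
  define V where "V = {?val y r | y r. y \<in> Rn d \<and> g y = ereal r}"
  define m where "m = Inf V"
  obtain x' where "x' \<in> Rn d" "g x' \<noteq> \<infinity>" "g x' \<noteq> -\<infinity>" using proper unfolding proper_fun_def by blast
  then have "V \<noteq> {}" unfolding V_def by (cases "g x'") auto
  have bb: "bdd_below V" unfolding V_def using bdd by (intro bdd_belowI[of _ b]) auto
  have m_le: "m \<le> ?val y r" if "y \<in> Rn d" "g y = ereal r" for y r
    unfolding m_def by (rule cInf_lower[OF _ bb]) (use that in \<open>auto simp: V_def\<close>)
  have "\<exists>y r. y \<in> Rn d \<and> g y = ereal r \<and> ?val y r < m + inverse (real (Suc n))" for n
  proof -
    have "Inf V < m + inverse (real (Suc n))" unfolding m_def by simp
    then obtain v where "v \<in> V" "v < m + inverse (real (Suc n))"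
      using cInf_lessD[OF \<open>V \<noteq> {}\<close>] by blast
    then show ?thesis unfolding V_def by blast
  qed
  then obtain Y R where Y: "\<And>n. Y n \<in> Rn d" and R: "\<And>n. g (Y n) = ereal (R n)"
    and val: "\<And>n. ?val (Y n) (R n) < m + inverse (real (Suc n))"
    by metis
  have close: "(norm_n d (Y j - Y k))\<^sup>2 / 4 \<le> inverse (real (Suc j)) + inverse (real (Suc k))" for j k
  proof -
    have avg: "A / 2 + B / 2 - D \<le> m + (a + b) / 2 - D" if "A < m + a" "B < m + b" for A B D a b
      using that by (simp add: field_simps)
    let ?mid = "\<lambda>i. (1 - 1/2) * Y j i + 1/2 * Y k i"
    obtain q where q: "g ?mid = ereal q" "q \<le> (1 - 1/2) * R j + 1/2 * R k"
      by (rule convex_fun_finite[OF cv proper Y Y R R, of "1/2" j k]) auto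
    have "m \<le> ?val ?mid q" by (intro m_le q(1) Rn_affine Y)
    also have "\<dots> \<le> ?val ?mid (R j / 2 + R k / 2)" using q \<eta> by simp
    also have "\<dots> = ?val (Y j) (R j) / 2 + ?val (Y k) (R k) / 2 - (norm_n d (Y j - Y k))\<^sup>2 / 8"
      unfolding norm_n_sq_midpoint by (simp add: field_simps)
    also have "\<dots> \<le> m + (inverse (real (Suc j)) + inverse (real (Suc k))) / 2
         - (norm_n d (Y j - Y k))\<^sup>2 / 8"
      by (rule avg[OF val val])
    finally show ?thesis by simp
  qed
  have cauchy: "\<exists>M. \<forall>j\<ge>M. \<forall>k\<ge>M. norm_n d (Y j - Y k) < e" if "0 < e" for e
  proof -
    obtain M where M: "inverse (real (Suc M)) < e\<^sup>2 / 8"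
      using reals_Archimedean[of "e\<^sup>2 / 8"] \<open>0 < e\<close> by auto
    have "norm_n d (Y j - Y k) < e" if "M \<le> j" "M \<le> k" for j k
    proof -
      have "inverse (real (Suc j)) \<le> inverse (real (Suc M))" "inverse (real (Suc k)) \<le> inverse (real (Suc M))"
        using that by (auto intro!: le_imp_inverse_le)
      with close[of j k] M have "(norm_n d (Y j - Y k))\<^sup>2 < e\<^sup>2" by linarith
      then show ?thesis using \<open>0 < e\<close> by (simp add: power2_less_imp_less)
    qed
    then show ?thesis by blast
  qed
  obtain z where z: "z \<in> Rn d" and lim: "\<And>i. (\<lambda>n. Y n i) \<longlonglongrightarrow> z i"
    using norm_n_complete[of Y d, OF Y cauchy] by blast
  have norm_lim: "(\<lambda>n. (norm_n d (Y n - w))\<^sup>2 / 2) \<longlonglongrightarrow> (norm_n d (z - w))\<^sup>2 / 2"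
    unfolding norm_n_sq inner_n_def minus_apply by (intro tendsto_intros lim) simp
  \<comment> \<open>\<open>a\<close> is the value of \<open>g\<close> at \<open>z\<close> that makes the penalized value at \<open>z\<close> equal to \<open>m\<close>.\<close>
  define a where "a = (m - (norm_n d (z - w))\<^sup>2 / 2) / \<eta>"
  have "(\<lambda>n. (m + inverse (real (Suc n)) - (norm_n d (Y n - w))\<^sup>2 / 2) / \<eta>) \<longlonglongrightarrow>
        (m + 0 - (norm_n d (z - w))\<^sup>2 / 2) / \<eta>"
    using \<eta> by (intro tendsto_intros LIMSEQ_inverse_real_of_nat norm_lim) auto
  then have R_lim: "(\<lambda>n. (m + inverse (real (Suc n)) - (norm_n d (Y n - w))\<^sup>2 / 2) / \<eta>) \<longlonglongrightarrow> a"
    by (simp add: a_def)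
  have R_le: "R n \<le> (m + inverse (real (Suc n)) - (norm_n d (Y n - w))\<^sup>2 / 2) / \<eta>" for n
    using val[of n] \<eta> by (simp add: pos_le_divide_eq mult.commute)
  have "g z \<le> ereal a"
  proof (rule ccontr)
    assume "\<not> g z \<le> ereal a"
    then obtain a' where a': "ereal a < ereal a'" "ereal a' < g z"
      by (metis ereal_dense2 not_le)
    have "\<forall>\<^sub>F n in sequentially. ereal a' < g (Y n)"
      by (rule lsc_fun_sequentially[OF lsc Y z lim a'(2)])
    then have "\<forall>\<^sub>F n in sequentially. a' \<le> (m + inverse (real (Suc n)) - (norm_n d (Y n - w))\<^sup>2 / 2) / \<eta>"
    proof (rule eventually_mono)
      fix n assume "ereal a' < g (Y n)"
      then show "a' \<le> (m + inverse (real (Suc n)) - (norm_n d (Y n - w))\<^sup>2 / 2) / \<eta>"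
        using R[of n] R_le[of n] by simp
    qed
    then have "a' \<le> a" by (rule tendsto_lowerbound[OF R_lim]) simp
    with a' show False by simp
  qed
  moreover have "g z \<noteq> -\<infinity>" using proper z by (simp add: proper_fun_def)
  ultimately obtain s where s: "g z = ereal s" "s \<le> a" by (cases "g z") auto
  then have "\<eta> * s \<le> m - (norm_n d (z - w))\<^sup>2 / 2"
    using \<eta> by (simp add: a_def pos_le_divide_eq mult.commute)
  then have "?\<Phi> z \<le> ereal m" using s by simp
  moreover have "ereal m \<le> ?\<Phi> y" if y: "y \<in> Rn d" for y
  proof (cases "g y")
    case (real r)
    then show ?thesis using m_le[OF y] by simp
  next
    case PInf then show ?thesis using \<eta> by simp
  next
    case MInf then show ?thesis using proper y by (simp add: proper_fun_def)
  qed
  ultimately have "is_arg_min ?\<Phi> (\<lambda>x. x \<in> Rn d) z"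
    using z unfolding is_arg_min_def by (metis leD order_trans)
  then show ?thesis unfolding prox_def arg_min_def by (rule someI[of "is_arg_min ?\<Phi> (\<lambda>x. x \<in> Rn d)"])
qed

text \<open>
  The variational form of optimality: \<open>(w - p) / \<eta>\<close> is a subgradient of \<open>g\<close> at \<open>p\<close>.  It follows by comparing
  \<open>p\<close> with points \<open>p + k (u - p)\<close> of the segment towards \<open>u\<close>, where \<open>g\<close> is at most its linear
  interpolation and the quadratic term changes by \<open>k \<langle>p - w, u - p\<rangle>\<close> up to second order in \<open>k\<close>.
\<close>

lemma prox_optimality:
  assumes \<eta>: "0 < \<eta>" and proper: "proper_fun d g" and cv: "convex_fun d g"
    and am: "is_arg_min (\<lambda>x. ereal ((norm_n d (x - w))\<^sup>2 / 2) + ereal \<eta> * g x) (\<lambda>x. x \<in> Rn d) p"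
  obtains s where "p \<in> Rn d" "g p = ereal s"
    and "\<And>u r. u \<in> Rn d \<Longrightarrow> g u = ereal r \<Longrightarrow> \<eta> * s + inner_n d (w - p) (u - p) \<le> \<eta> * r"
proof -
  let ?\<Phi> = "\<lambda>x. ereal ((norm_n d (x - w))\<^sup>2 / 2) + ereal \<eta> * g x"
  have p: "p \<in> Rn d" and min: "\<And>y. y \<in> Rn d \<Longrightarrow> ?\<Phi> p \<le> ?\<Phi> y"
    using am unfolding is_arg_min_def by (auto simp: not_less)
  obtain x' where x': "x' \<in> Rn d" "g x' \<noteq> \<infinity>" "g x' \<noteq> -\<infinity>" using proper unfolding proper_fun_def by blast
  then have "?\<Phi> x' < \<infinity>" by (cases "g x'") auto
  then have "?\<Phi> p \<noteq> \<infinity>" using min[OF x'(1)] by auto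
  then have "g p \<noteq> \<infinity>" using \<eta> by auto
  moreover have "g p \<noteq> -\<infinity>" using proper p by (simp add: proper_fun_def)
  ultimately obtain s where s: "g p = ereal s" by (cases "g p") auto
  have "\<eta> * s + inner_n d (w - p) (u - p) \<le> \<eta> * r" if u: "u \<in> Rn d" and r: "g u = ereal r" for u r
  proof (rule le_of_le_add_small)
    fix k :: real assume k: "0 < k" "k < 1"
    define h where "h = u - p"
    obtain q where q: "g (\<lambda>i. (1 - k) * p i + k * u i) = ereal q" "q \<le> (1 - k) * s + k * r"
      by (rule convex_fun_finite[OF cv proper p u s r k])
    have seg: "(\<lambda>i. (1 - k) * p i + k * u i) = (\<lambda>i. p i + k * h i)"
      by (auto simp: h_def algebra_simps)
    have "?\<Phi> p \<le> ?\<Phi> (\<lambda>i. (1 - k) * p i + k * u i)" by (intro min Rn_affine p u)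
    then have "(norm_n d (p - w))\<^sup>2 / 2 + \<eta> * s \<le> (norm_n d ((\<lambda>i. p i + k * h i) - w))\<^sup>2 / 2 + \<eta> * q"
      using q(1) s unfolding seg by simp
    also have "\<dots> \<le> (norm_n d ((\<lambda>i. p i + k * h i) - w))\<^sup>2 / 2 + \<eta> * ((1 - k) * s + k * r)"
      using q \<eta> by simp
    finally have "k * (\<eta> * s) \<le> k * (inner_n d (p - w) h + \<eta> * r + k * ((norm_n d h)\<^sup>2 / 2))"
      unfolding norm_n_sq_ray by (simp add: field_simps power2_eq_square)
    then have "\<eta> * s \<le> inner_n d (p - w) h + \<eta> * r + k * ((norm_n d h)\<^sup>2 / 2)"
      using k by simp
    then show "\<eta> * s + inner_n d (w - p) (u - p) \<le> \<eta> * r + k * ((norm_n d h)\<^sup>2 / 2)"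
      unfolding h_def[symmetric] by (simp add: inner_n_diff_left)
  qed
  then show ?thesis using that p s by blast
qed

section \<open>One proximal gradient step\<close>

text \<open>
  The minimizers form the set \<open>Sol\<close>, and \<open>gap x\<close> is \<open>F x - F\<^sub>*\<close>.  The real-valued \<open>gap\<close> and \<open>g_real\<close> represent
  the extended-real quantities only on the effective domain \<open>eff_dom\<close> of \<open>g\<close>, which contains the minimizers
  and the result of every step.
\<close>

locale composite_objective =
  fixes d :: nat and f :: "(nat \<Rightarrow> real) \<Rightarrow> real" and g :: "(nat \<Rightarrow> real) \<Rightarrow> ereal" and L :: real
  assumes convex_f: "convex_fun d (\<lambda>x. ereal (f x))" and smooth: "L_smooth d L f"
    and proper: "proper_fun d g" and lsc: "lsc_fun d g" and convex_g: "convex_fun d g"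
    and minimizers_nonempty: "minimizers d (objective f g) \<noteq> {}"
begin

lemma L_pos: "0 < L"
  using smooth by (simp add: L_smooth_def)

abbreviation Sol :: "(nat \<Rightarrow> real) set"
  where "Sol \<equiv> minimizers d (objective f g)"

definition eff_dom :: "(nat \<Rightarrow> real) set"
  where "eff_dom = {x \<in> Rn d. \<bar>g x\<bar> \<noteq> \<infinity>}"

definition gap :: "(nat \<Rightarrow> real) \<Rightarrow> real"
  where "gap x = real_of_ereal (objective f g x - min_value d (objective f g))"

definition g_real :: "(nat \<Rightarrow> real) \<Rightarrow> real"
  where "g_real x = real_of_ereal (g x)"

definition step :: "(nat \<Rightarrow> real) \<Rightarrow> (nat \<Rightarrow> real)"
  where "step x = prox d (1 / L) g (\<lambda>i. x i - gradient d f x i / L)"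

lemma eff_dom_in_Rn: "x \<in> eff_dom \<Longrightarrow> x \<in> Rn d"
  by (simp add: eff_dom_def)

lemma g_on_eff_dom: "x \<in> eff_dom \<Longrightarrow> g x = ereal (g_real x)"
  by (simp add: eff_dom_def g_real_def ereal_real')

lemma min_value_eq: "u \<in> Sol \<Longrightarrow> min_value d (objective f g) = objective f g u"
  unfolding min_value_def minimizers_def is_arg_min_def
  by (auto intro!: antisym INF_lower INF_greatest simp: not_less)

lemma Sol_subset_eff_dom: "Sol \<subseteq> eff_dom"
proof
  fix u assume u: "u \<in> Sol"
  then have R: "u \<in> Rn d" and min: "\<And>y. y \<in> Rn d \<Longrightarrow> objective f g u \<le> objective f g y"
    by (auto simp: minimizers_def is_arg_min_def not_less)
  obtain x' where x': "x' \<in> Rn d" "g x' \<noteq> \<infinity>" using proper unfolding proper_fun_def by blast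
  have "objective f g u \<noteq> \<infinity>" using min[OF x'(1)] x'(2) by (auto simp: objective_def)
  then have "g u \<noteq> \<infinity>" by (auto simp: objective_def)
  moreover have "g u \<noteq> -\<infinity>" using proper R by (simp add: proper_fun_def)
  ultimately show "u \<in> eff_dom" using R by (cases "g u") (auto simp: eff_dom_def)
qed

lemma gap_difference:
  assumes "x \<in> eff_dom" "u \<in> Sol"
  shows "gap x = f x + g_real x - (f u + g_real u)"
    and "objective f g x - min_value d (objective f g) = ereal (gap x)"
proof -
  have "u \<in> eff_dom" using assms Sol_subset_eff_dom by blast
  then have "objective f g x - min_value d (objective f g) = ereal (f x + g_real x - (f u + g_real u))"
    unfolding min_value_eq[OF assms(2)] objective_def using assms(1) by (simp add: g_on_eff_dom)
  then show "gap x = f x + g_real x - (f u + g_real u)"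
    and "objective f g x - min_value d (objective f g) = ereal (gap x)"
    unfolding gap_def by simp_all
qed

lemma gap_nonneg:
  assumes "x \<in> eff_dom" shows "0 \<le> gap x"
proof -
  obtain u where u: "u \<in> Sol" using minimizers_nonempty by blast
  have "objective f g u \<le> objective f g x"
    using u eff_dom_in_Rn[OF assms] by (auto simp: minimizers_def is_arg_min_def not_less)
  then show ?thesis
    using u Sol_subset_eff_dom assms by (auto simp: gap_difference(1)[OF assms u] objective_def g_on_eff_dom subset_iff)
qed

lemma gap_minimizer: "u \<in> Sol \<Longrightarrow> gap u = 0"
  using gap_difference(1)[of u u] Sol_subset_eff_dom by auto

text \<open>
  The problem solved in a step is bounded below: up to the factor \<open>L\<close> and a constant, its objective is the
  quadratic model \<open>f x + \<langle>\<nabla>f x, y - x\<rangle> + L/2 \<parallel>y - x\<parallel>\<^sup>2 + g y\<close>, which by the descent lemma lies above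
  \<open>F y \<ge> F\<^sub>*\<close>.
\<close>

lemma
  assumes x: "x \<in> Rn d"
  shows step_in_eff_dom: "step x \<in> eff_dom"
    and step_subgradient: "u \<in> eff_dom \<Longrightarrow> g_real (step x) + L * inner_n d (x - step x) (u - step x)
          - inner_n d (gradient d f x) (u - step x) \<le> g_real u"
proof -
  let ?G = "gradient d f x"
  let ?w = "\<lambda>i. x i - ?G i / L"
  obtain u0 where u0: "u0 \<in> Sol" using minimizers_nonempty by blast
  define m where "m = f u0 + g_real u0"
  have "(m - f x) / L \<le> (norm_n d (y - ?w))\<^sup>2 / 2 + 1 / L * r" if y: "y \<in> Rn d" "g y = ereal r" for y r
  proof -
    have yd: "y \<in> eff_dom" and r: "r = g_real y" using y by (auto simp: eff_dom_def g_real_def)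
    have w: "y - ?w = (\<lambda>i. y i + 1 / L * ?G i) - x" by auto
    have "m \<le> f y + r"
      using gap_nonneg[OF yd] gap_difference(1)[OF yd u0] by (simp add: m_def r)
    also have "\<dots> \<le> f x + inner_n d (y - x) ?G + L / 2 * (norm_n d (y - x))\<^sup>2 + r"
      using descent_lemma[OF smooth x y(1)] by (simp add: inner_n_commute)
    also have "\<dots> \<le> f x + L * ((norm_n d (y - ?w))\<^sup>2 / 2 + 1 / L * r)"
      unfolding w norm_n_sq_ray using L_pos by (simp add: field_simps power2_eq_square)
    finally show ?thesis using L_pos by (simp add: pos_divide_le_eq mult.commute)
  qed
  then have "is_arg_min (\<lambda>x. ereal ((norm_n d (x - ?w))\<^sup>2 / 2) + ereal (1 / L) * g x) (\<lambda>x. x \<in> Rn d) (step x)"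
    unfolding step_def using L_pos by (intro prox_is_arg_min proper lsc convex_g) auto
  then obtain s where p: "step x \<in> Rn d" "g (step x) = ereal s" and
    opt: "\<And>u r. u \<in> Rn d \<Longrightarrow> g u = ereal r \<Longrightarrow>
       1 / L * s + inner_n d (?w - step x) (u - step x) \<le> 1 / L * r"
    using prox_optimality[OF _ proper convex_g, of "1 / L" ?w "step x"] L_pos by auto
  show "step x \<in> eff_dom" using p by (simp add: eff_dom_def)
  assume u: "u \<in> eff_dom"
  have "inner_n d (?w - step x) (u - step x)
      = inner_n d (x - step x) (u - step x) - inner_n d ?G (u - step x) / L"
    unfolding inner_n_def sum_divide_distrib sum_subtractf[symmetric]
    by (intro sum.cong refl) (simp add: algebra_simps diff_divide_distrib)
  then have "1 / L * s + (inner_n d (x - step x) (u - step x) - inner_n d ?G (u - step x) / L) \<le> 1 / L * g_real u"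
    using opt[OF eff_dom_in_Rn[OF u] g_on_eff_dom[OF u]] by simp
  then have "L * (1 / L * s + (inner_n d (x - step x) (u - step x) - inner_n d ?G (u - step x) / L))
      \<le> L * (1 / L * g_real u)"
    using L_pos by (intro mult_left_mono) auto
  then have "s + L * inner_n d (x - step x) (u - step x) - inner_n d ?G (u - step x) \<le> g_real u"
    using L_pos by (simp add: distrib_left right_diff_distrib)
  then show "g_real (step x) + L * inner_n d (x - step x) (u - step x)
          - inner_n d ?G (u - step x) \<le> g_real u"
    using p by (simp add: g_real_def)
qed

text \<open>
  The basic inequality of proximal gradient descent.  It is the sum of the descent lemma between \<open>x\<close> and
  \<open>step x\<close>, the gradient inequality of \<open>f\<close> at \<open>x\<close> and the subgradient inequality of \<open>g\<close> at \<open>step x\<close>; the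
  inner products complete the square \<open>\<parallel>u - x\<parallel>\<^sup>2\<close>.  Taking \<open>u = x\<close> gives monotone decrease, taking \<open>u\<close> a
  minimizer gives the convergence rate.
\<close>

lemma gap_step:
  assumes x: "x \<in> Rn d" and u: "u \<in> eff_dom"
  shows "gap (step x) + L / 2 * (norm_n d (u - step x))\<^sup>2 \<le> gap u + L / 2 * (norm_n d (u - x))\<^sup>2"
proof -
  let ?p = "step x" let ?G = "gradient d f x"
  obtain u0 where u0: "u0 \<in> Sol" using minimizers_nonempty by blast
  note p = step_in_eff_dom[OF x]
  have "f ?p \<le> f x + inner_n d ?G (?p - x) + L / 2 * (norm_n d (?p - x))\<^sup>2"
    by (rule descent_lemma[OF smooth x eff_dom_in_Rn[OF p]])
  moreover have "f x + inner_n d ?G (u - x) \<le> f u"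
    by (rule convex_gradient_ineq[OF smooth convex_f x eff_dom_in_Rn[OF u]])
  moreover note step_subgradient[OF x u]
  moreover have "inner_n d ?G (?p - x) + inner_n d ?G (u - ?p) = inner_n d ?G (u - x)"
    by (simp add: inner_n_diff_right)
  moreover have "(norm_n d (u - x))\<^sup>2 = (norm_n d (u - ?p))\<^sup>2 + (norm_n d (?p - x))\<^sup>2
      - 2 * inner_n d (x - ?p) (u - ?p)"
    unfolding norm_n_sq inner_n_def sum_distrib_left sum_subtractf[symmetric] sum.distrib[symmetric]
    by (intro sum.cong refl) (simp add: algebra_simps)
  then have "L / 2 * (norm_n d (u - x))\<^sup>2 = L / 2 * (norm_n d (u - ?p))\<^sup>2
      + L / 2 * (norm_n d (?p - x))\<^sup>2 - L * inner_n d (x - ?p) (u - ?p)"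
    by (simp only:) (simp add: algebra_simps)
  ultimately show ?thesis
    unfolding gap_difference(1)[OF p u0] gap_difference(1)[OF u u0] by linarith
qed

lemma gap_step_decrease:
  assumes "x \<in> eff_dom"
  shows "gap (step x) + L / 2 * (norm_n d (x - step x))\<^sup>2 \<le> gap x"
  using gap_step[OF eff_dom_in_Rn[OF assms] assms] by (simp add: norm_n_def L2_set_def)

lemma le_dist_to:
  assumes "\<And>u. u \<in> Sol \<Longrightarrow> a \<le> norm_n d (x - u)"
  shows "a \<le> dist_to d x Sol"
  unfolding dist_to_def using assms minimizers_nonempty by (intro cINF_greatest) auto

text \<open>
  The vector \<open>\<nabla>f p - \<nabla>f x + L (x - p)\<close> is a subgradient of \<open>F\<close> at \<open>p = step x\<close> of norm at most
  \<open>2 L \<parallel>x - p\<parallel>\<close>.  Under a sharp error bound this shows that a step that does not reach a minimizer cannot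
  be short.
\<close>

lemma gap_step_le_displacement:
  assumes x: "x \<in> Rn d"
  shows "gap (step x) \<le> 2 * L * norm_n d (x - step x) * dist_to d (step x) Sol"
proof (cases "norm_n d (x - step x) = 0")
  case False
  let ?p = "step x"
  note p = step_in_eff_dom[OF x]
  from False have N: "0 < 2 * L * norm_n d (x - ?p)"
    using L_pos norm_n_nonneg[of d "x - ?p"] by (simp add: less_le)
  have "gap ?p / (2 * L * norm_n d (x - ?p)) \<le> norm_n d (?p - u)" if u: "u \<in> Sol" for u
  proof -
    have ud: "u \<in> eff_dom" using u Sol_subset_eff_dom by blast
    let ?Gp = "gradient d f ?p" and ?Gx = "gradient d f x"
    have "f ?p + inner_n d ?Gp (u - ?p) \<le> f u"
      by (rule convex_gradient_ineq[OF smooth convex_f eff_dom_in_Rn[OF p] eff_dom_in_Rn[OF ud]])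
    then have "gap ?p \<le> inner_n d (?Gx - ?Gp) (u - ?p) + L * inner_n d (?p - x) (u - ?p)"
      using step_subgradient[OF x ud] 
      by (simp add: gap_difference(1)[OF p u] inner_n_diff_left algebra_simps)
    also have "\<dots> \<le> norm_n d (?Gx - ?Gp) * norm_n d (u - ?p) + L * (norm_n d (?p - x) * norm_n d (u - ?p))"
      using L_pos by (intro add_mono mult_left_mono inner_n_le_norm_n) auto
    also have "\<dots> \<le> L * norm_n d (x - ?p) * norm_n d (u - ?p) + L * (norm_n d (?p - x) * norm_n d (u - ?p))"
      using smooth x eff_dom_in_Rn[OF p] unfolding L_smooth_def
      by (intro add_mono mult_right_mono) auto
    also have "\<dots> = 2 * L * norm_n d (x - ?p) * norm_n d (?p - u)"
      by (simp add: norm_n_minus_commute[of d u] norm_n_minus_commute[of d ?p x])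
    finally show ?thesis using N by (simp add: pos_divide_le_eq mult.commute)
  qed
  then have "gap ?p / (2 * L * norm_n d (x - ?p)) \<le> dist_to d ?p Sol" by (rule le_dist_to)
  then show ?thesis using N by (simp add: pos_divide_le_eq mult.commute)
next
  case True
  obtain u where u: "u \<in> Sol" using minimizers_nonempty by blast
  \<comment> \<open>A step of length zero ends at a minimizer: \<open>0\<close> is then a subgradient of \<open>F\<close> at \<open>x\<close>.\<close>
  have "\<And>i. x i = step x i"
  proof -
    fix i
    show "x i = step x i"
      using coord_le_norm_n[of i d "x - step x"] True x eff_dom_in_Rn[OF step_in_eff_dom[OF x]]
      by (cases "i < d") (auto simp: Rn_iff)
  qed
  then have "x = step x" by auto
  have "f (step x) + inner_n d (gradient d f (step x)) (u - step x) \<le> f u"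
    using u Sol_subset_eff_dom
    by (intro convex_gradient_ineq[OF smooth convex_f eff_dom_in_Rn[OF step_in_eff_dom[OF x]]] eff_dom_in_Rn) auto
  moreover have "g_real (step x) + L * inner_n d (x - step x) (u - step x)
          - inner_n d (gradient d f x) (u - step x) \<le> g_real u"
    using u Sol_subset_eff_dom by (intro step_subgradient x) auto
  ultimately have "gap (step x) \<le> 0"
    unfolding gap_difference(1)[OF step_in_eff_dom[OF x] u] using \<open>x = step x\<close>[symmetric]
    by (simp add: inner_n_diff_left)
  then show ?thesis using True by simp
qed

section \<open>Rates along the iteration\<close>

context
  fixes x0 :: "nat \<Rightarrow> real" and c \<theta> \<epsilon>0 :: real
  assumes x0: "x0 \<in> Rn d"
    and initial_gap: "objective f g x0 - min_value d (objective f g) \<le> ereal \<epsilon>0"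
    and heb: "HEB d (objective f g) \<epsilon>0 \<theta> c"
begin

abbreviation X :: "nat \<Rightarrow> nat \<Rightarrow> real"
  where "X \<equiv> pg d L f g x0"

lemma X_Suc: "X (Suc t) = step (X t)"
  by (simp add: step_def)

lemma X_in_eff_dom: "X t \<in> eff_dom"
proof (induction t)
  case 0
  obtain u where u: "u \<in> Sol" using minimizers_nonempty by blast
  then have "u \<in> eff_dom" using Sol_subset_eff_dom by blast
  have "g x0 \<noteq> \<infinity>"
    using initial_gap \<open>u \<in> eff_dom\<close> unfolding min_value_eq[OF u] objective_def by (auto simp: g_on_eff_dom)
  moreover have "g x0 \<noteq> -\<infinity>" using proper x0 by (simp add: proper_fun_def)
  ultimately show ?case using x0 by (cases "g x0") (auto simp: eff_dom_def)
next
  case (Suc t)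
  then show ?case unfolding X_Suc by (intro step_in_eff_dom eff_dom_in_Rn)
qed

lemma objective_gap_X: "objective f g (X t) - min_value d (objective f g) = ereal (gap (X t))"
  using gap_difference(2)[OF X_in_eff_dom] minimizers_nonempty by blast

lemma gap_Suc_le: "gap (X (Suc t)) \<le> gap (X t)"
proof -
  have "0 \<le> L / 2 * (norm_n d (X t - step (X t)))\<^sup>2" using L_pos by simp
  then show ?thesis unfolding X_Suc using gap_step_decrease[OF X_in_eff_dom[of t]] by linarith
qed

lemma gap_antimono: "s \<le> t \<Longrightarrow> gap (X t) \<le> gap (X s)"
  by (rule lift_Suc_antimono_le[of "\<lambda>t. gap (X t)", OF gap_Suc_le])

lemma gap_le_initial: "gap (X t) \<le> \<epsilon>0"
proof -
  have "gap (X 0) \<le> \<epsilon>0" using initial_gap objective_gap_X[of 0] by simp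
  then show ?thesis using gap_antimono[of 0 t] by simp
qed

lemma heb_X: "dist_to d (X t) Sol \<le> c * gap (X t) powr \<theta>"
proof -
  have "X t \<in> sublevel d (objective f g) \<epsilon>0"
    using gap_le_initial[of t] eff_dom_in_Rn[OF X_in_eff_dom[of t]] by (simp add: sublevel_def objective_gap_X)
  with heb show ?thesis unfolding HEB_def gap_def by blast
qed

text \<open>
  The quantity \<open>k gap (X (s + k)) + L/2 \<parallel>u - X (s + k)\<parallel>\<^sup>2\<close> does not increase with \<open>k\<close>, by \<open>gap_step\<close> and the
  monotonicity of the gap.
\<close>

lemma gap_after_k_steps_le_distance:
  assumes u: "u \<in> Sol"
  shows "real k * gap (X (s + k)) + L / 2 * (norm_n d (u - X (s + k)))\<^sup>2
           \<le> L / 2 * (norm_n d (u - X s))\<^sup>2"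
proof (induction k)
  case (Suc k)
  have "gap (X (s + Suc k)) + L / 2 * (norm_n d (u - X (s + Suc k)))\<^sup>2
          \<le> L / 2 * (norm_n d (u - X (s + k)))\<^sup>2"
    using gap_step[OF eff_dom_in_Rn[OF X_in_eff_dom[of "s + k"]], of u] u Sol_subset_eff_dom gap_minimizer[OF u]
    by (auto simp: X_Suc simp del: pg.simps)
  moreover have "real k * gap (X (s + Suc k)) \<le> real k * gap (X (s + k))"
    by (intro mult_left_mono gap_antimono) auto
  moreover have "real (Suc k) * gap (X (s + Suc k)) = real k * gap (X (s + Suc k)) + gap (X (s + Suc k))"
    by (simp add: distrib_right del: pg.simps)
  ultimately show ?case using Suc.IH by linarith
qed simp

text \<open>
  The sublinear rate \<open>L D(x\<^sub>s, \<Omega>\<^sub>*)\<^sup>2 / (2 k)\<close> combined with the error bound at \<open>x\<^sub>s\<close>.  The square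
  root lets the bound pass to the infimum over the minimizers without showing that the distance is
  attained.
\<close>

lemma gap_rate: "2 * real k * gap (X (s + k)) \<le> c\<^sup>2 * L * gap (X s) powr (2 * \<theta>)"
proof -
  have gap: "0 \<le> gap (X t)" for t by (rule gap_nonneg[OF X_in_eff_dom])
  have "sqrt (2 * real k * gap (X (s + k)) / L) \<le> dist_to d (X s) Sol"
  proof (rule le_dist_to)
    fix u assume "u \<in> Sol"
    have "0 \<le> L / 2 * (norm_n d (u - X (s + k)))\<^sup>2" using L_pos by simp
    then have "2 * real k * gap (X (s + k)) \<le> L * (norm_n d (u - X s))\<^sup>2"
      using gap_after_k_steps_le_distance[OF \<open>u \<in> Sol\<close>, of k s] by linarith
    then have "2 * real k * gap (X (s + k)) / L \<le> (norm_n d (X s - u))\<^sup>2"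
      using L_pos by (simp add: pos_divide_le_eq norm_n_minus_commute[of d "X s"] mult.commute[of L])
    then show "sqrt (2 * real k * gap (X (s + k)) / L) \<le> norm_n d (X s - u)"
      by (simp add: real_le_lsqrt)
  qed
  also have "\<dots> \<le> c * gap (X s) powr \<theta>" by (rule heb_X)
  finally have "(sqrt (2 * real k * gap (X (s + k)) / L))\<^sup>2 \<le> (c * gap (X s) powr \<theta>)\<^sup>2"
    using gap L_pos by (intro power_mono) auto
  moreover have "(gap (X s) powr \<theta>)\<^sup>2 = gap (X s) powr (2 * \<theta>)"
    by (simp add: power2_eq_square powr_add[symmetric])
  ultimately show ?thesis
    using gap L_pos by (simp add: power_mult_distrib pos_divide_le_eq mult.commute mult.left_commute)
qed

text \<open>
  For \<open>\<theta> = 1\<close> the gap cancels from \<open>gap p \<le> 2 L \<parallel>x - p\<parallel> D(p, \<Omega>\<^sub>*) \<le> 2 L c \<parallel>x - p\<parallel> gap p\<close>, so the step has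
  length at least \<open>1 / (2 c L)\<close> and the gap drops by \<open>L/2\<close> times its square.
\<close>

lemma sharp_gap_decrease:
  assumes c: "0 < c" and \<theta>: "\<theta> = 1" and pos: "0 < gap (X (Suc t))"
  shows "gap (X (Suc t)) + 1 / (8 * (c\<^sup>2 * L)) \<le> gap (X t)"
proof -
  let ?N = "norm_n d (X t - X (Suc t))"
  have "gap (X (Suc t)) \<le> 2 * L * ?N * dist_to d (X (Suc t)) Sol"
    unfolding X_Suc by (rule gap_step_le_displacement[OF eff_dom_in_Rn[OF X_in_eff_dom]])
  also have "\<dots> \<le> 2 * L * ?N * (c * gap (X (Suc t)))"
    using heb_X[of "Suc t"] pos L_pos \<theta> by (intro mult_left_mono) auto
  finally have "gap (X (Suc t)) * 1 \<le> gap (X (Suc t)) * (2 * L * c * ?N)"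
    by (simp add: algebra_simps)
  then have "1 \<le> 2 * L * c * ?N" using pos by (simp only: mult_le_cancel_left_pos)
  then have "1\<^sup>2 \<le> (2 * L * c * ?N)\<^sup>2" by (rule power_mono) simp
  then have "1 / (8 * (c\<^sup>2 * L)) \<le> L / 2 * ?N\<^sup>2"
    using c L_pos by (simp add: divide_simps power_mult_distrib) (simp add: power2_eq_square algebra_simps)
  then show ?thesis using gap_step_decrease[OF X_in_eff_dom[of t]] unfolding X_Suc by linarith
qed

end

end

section \<open>Counting iterations\<close>

text \<open>
  While the gap is at most \<open>\<xi>\<close>, choosing \<open>k \<ge> A \<xi>\<^bsup>2\<theta>-1\<^esup>\<close> in the rate gives
  \<open>2 k \<delta> \<le> A \<xi>\<^bsup>2\<theta>\<^esup> \<le> k \<xi>\<close>, that is, a gap of at most \<open>\<xi> / 2\<close>.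
\<close>

lemma halving_stages:
  fixes \<delta> :: "nat \<Rightarrow> real"
  assumes anti: "\<And>s t. s \<le> t \<Longrightarrow> \<delta> t \<le> \<delta> s" and nonneg: "\<And>t. 0 \<le> \<delta> t"
    and rate: "\<And>s k. 2 * real k * \<delta> (s + k) \<le> A * \<delta> s powr (2 * \<theta>)"
    and A: "0 < A" and \<theta>: "0 < \<theta>" and start: "\<delta> 0 \<le> \<epsilon>0" and "0 < \<epsilon>0"
    and t: "(\<Sum>j<K. \<lceil>A * (\<epsilon>0 / 2 ^ j) powr (2 * \<theta> - 1)\<rceil>) \<le> int t"
  shows "\<delta> t \<le> \<epsilon>0 / 2 ^ K"
  using t
proof (induction K arbitrary: t)
  case 0
  then show ?case using anti[of 0 t] start by simp
next
  case (Suc K)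
  define \<xi> where "\<xi> = \<epsilon>0 / 2 ^ K"
  have \<xi>: "0 < \<xi>" using \<open>0 < \<epsilon>0\<close> by (simp add: \<xi>_def)
  define k where "k = nat \<lceil>A * \<xi> powr (2 * \<theta> - 1)\<rceil>"
  have "0 < A * \<xi> powr (2 * \<theta> - 1)" using A \<xi> by simp
  then have k_pos: "0 < k" and k_ge: "A * \<xi> powr (2 * \<theta> - 1) \<le> real k"
    and k_int: "int k = \<lceil>A * \<xi> powr (2 * \<theta> - 1)\<rceil>"
    unfolding k_def by (simp_all add: real_nat_ceiling_ge) 
  have "0 \<le> (\<Sum>j<K. \<lceil>A * (\<epsilon>0 / 2 ^ j) powr (2 * \<theta> - 1)\<rceil>)"
    using A \<open>0 < \<epsilon>0\<close> by (intro sum_nonneg) (simp add: less_le_trans[of "-1" 0])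
  then have "k \<le> t" and "(\<Sum>j<K. \<lceil>A * (\<epsilon>0 / 2 ^ j) powr (2 * \<theta> - 1)\<rceil>) \<le> int (t - k)"
    using Suc.prems k_int by (simp_all add: \<xi>_def of_nat_diff)
  then have "\<delta> (t - k) \<le> \<xi>" unfolding \<xi>_def using Suc.IH by blast
  then have "\<delta> (t - k) powr (2 * \<theta>) \<le> \<xi> powr (2 * \<theta>)"
    using \<theta> nonneg by (intro powr_mono2) auto
  have "2 * real k * \<delta> t \<le> A * \<delta> (t - k) powr (2 * \<theta>)"
    using rate[of k "t - k"] \<open>k \<le> t\<close> by simp
  also have "\<dots> \<le> A * \<xi> powr (2 * \<theta>)"
    using \<open>_ powr _ \<le> _\<close> A by simp
  also have "\<dots> = A * \<xi> powr (2 * \<theta> - 1) * \<xi>"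
    using \<xi> by (simp add: powr_diff)
  also have "\<dots> \<le> real k * \<xi>" using k_ge \<xi> by (intro mult_right_mono) auto
  finally have "real k * (2 * \<delta> t) \<le> real k * \<xi>" by (simp add: mult_ac)
  then have "2 * \<delta> t \<le> \<xi>" using k_pos by simp
  then show ?case by (simp add: \<xi>_def)
qed

text \<open>
  The sum of the geometric series with ratio \<open>2 powr - \<bar>p\<bar>\<close>.  For ratio \<open>1\<close> it diverges; there \<open>3\<close> is the
  constant for which the bound \<open>1 + 2 ln (\<epsilon>\<^sub>0 / \<epsilon>)\<close> on the number of stages is at most
  \<open>3 max 1 (ln (\<epsilon>\<^sub>0 / \<epsilon>))\<close>.
\<close>

definition geometric_const :: "real \<Rightarrow> real"
  where "geometric_const p = (if p = 0 then 3 else 1 / (1 - 2 powr - \<bar>p\<bar>))"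

lemma geometric_const_ge_1: "1 \<le> geometric_const p"
proof -
  have "0 < 1 - 2 powr - \<bar>p\<bar>" if "p \<noteq> 0"
    using powr_less_mono[of "- \<bar>p\<bar>" 0 "2::real"] that by simp
  then show ?thesis by (simp add: geometric_const_def)
qed

lemma sum_powr_le_geometric_const:
  assumes "0 < p"
  shows "(\<Sum>j<K. (2 powr - p) ^ j) \<le> geometric_const p"
proof -
  have "(2::real) powr - p < 1" using powr_less_mono[of "- p" 0 "2::real"] assms by simp
  then show ?thesis
    using geometric_sum_less[of "2 powr - p" "{..<K}"] assms by (simp add: geometric_const_def)
qed

lemma powr_halving:
  fixes a p :: real
  assumes "0 \<le> a"
  shows "(a / 2 ^ j) powr p = a powr p * (2 powr - p) ^ j"
proof -
  have "(a / 2 ^ j) powr p = a powr p / (2 powr real j) powr p"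
    using assms by (simp add: powr_divide powr_realpow)
  also have "(2 powr real j) powr p = (2 powr p) ^ j"
    by (simp add: powr_powr powr_realpow[symmetric] mult.commute)
  finally show ?thesis by (simp add: powr_minus power_inverse divide_inverse)
qed

text \<open>
  The number of stages is at most \<open>1 + log\<^sub>2 (\<epsilon>\<^sub>0 / \<epsilon>)\<close>, and \<open>1 / ln 2 < 2\<close>.
\<close>

lemma number_of_stages:
  assumes \<epsilon>: "0 < \<epsilon>" "\<epsilon> < \<epsilon>0" and active: "\<And>j. j < K \<Longrightarrow> \<epsilon> < \<epsilon>0 / 2 ^ j"
  shows "real K \<le> 1 + 2 * ln (\<epsilon>0 / \<epsilon>)"
proof (cases K)
  case 0
  have "0 < ln (\<epsilon>0 / \<epsilon>)" using \<epsilon> by simp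
  with 0 show ?thesis by simp
next
  case (Suc n)
  have "2 ^ n < \<epsilon>0 / \<epsilon>" using active[of n] Suc \<epsilon> by (simp add: field_simps)
  then have "ln (2 ^ n) < ln (\<epsilon>0 / \<epsilon>)" using \<epsilon> by (subst ln_less_cancel_iff) auto
  then have "real n * ln 2 < ln (\<epsilon>0 / \<epsilon>)" by (simp add: ln_realpow)
  moreover have "real n * (1 / 2) \<le> real n * ln 2"
    using ln2_ge_two_thirds by (intro mult_left_mono) auto
  ultimately show ?thesis using Suc by simp
qed

text \<open>
  The costs form a geometric progression of ratio \<open>2 powr - p\<close> with \<open>p = 2 \<theta> - 1\<close>.  For \<open>p > 0\<close> the
  first one, at gap \<open>\<epsilon>\<^sub>0\<close>, dominates; for \<open>p < 0\<close> the last one does, whose gap still exceeds \<open>\<epsilon>\<close>; for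
  \<open>p = 0\<close> all are equal and their number matters.
\<close>

lemma sum_stage_costs_le:
  assumes A: "A = c\<^sup>2 * L" "0 < A" and \<epsilon>: "0 < \<epsilon>" "\<epsilon> < \<epsilon>0"
    and active: "\<And>j. j < K \<Longrightarrow> \<epsilon> < \<epsilon>0 / 2 ^ j"
  shows "(\<Sum>j<K. A * (\<epsilon>0 / 2 ^ j) powr (2 * \<theta> - 1))
           \<le> geometric_const (2 * \<theta> - 1) * pg_bound \<theta> c L \<epsilon>0 \<epsilon>"
proof -
  define p where "p = 2 * \<theta> - 1"
  consider "0 < p" | "p = 0" | "p < 0" by linarith
  then show ?thesis unfolding p_def[symmetric]
  proof cases
    case 1
    have "(\<Sum>j<K. A * (\<epsilon>0 / 2 ^ j) powr p) = A * \<epsilon>0 powr p * (\<Sum>j<K. (2 powr - p) ^ j)"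
      using \<epsilon> by (simp add: powr_halving sum_distrib_left mult.assoc)
    also have "\<dots> \<le> A * \<epsilon>0 powr p * geometric_const p"
      using A 1 by (intro mult_left_mono sum_powr_le_geometric_const) auto
    finally show "(\<Sum>j<K. A * (\<epsilon>0 / 2 ^ j) powr p) \<le> geometric_const p * pg_bound \<theta> c L \<epsilon>0 \<epsilon>"
      using 1 A by (simp add: pg_bound_def p_def mult.commute)
  next
    case 2
    let ?l = "ln (\<epsilon>0 / \<epsilon>)"
    have l: "0 < ?l" using \<epsilon> by simp
    have "real K \<le> 1 + 2 * ?l" by (rule number_of_stages) (use assms in auto)
    then have "A * real K \<le> A * (1 + 2 * ?l)" using A by (intro mult_left_mono) auto
    also have "\<dots> \<le> 3 * max A (A * ?l)" by (simp add: algebra_simps max_def)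
    also have "\<dots> = geometric_const p * pg_bound \<theta> c L \<epsilon>0 \<epsilon>"
      using 2 A \<epsilon> by (simp add: geometric_const_def pg_bound_def p_def)
    finally show "(\<Sum>j<K. A * (\<epsilon>0 / 2 ^ j) powr p) \<le> geometric_const p * pg_bound \<theta> c L \<epsilon>0 \<epsilon>"
      using 2 \<epsilon> by (simp add: mult.commute)
  next
    case 3
    have "(\<Sum>j<K. (\<epsilon>0 / 2 ^ j) powr p) \<le> \<epsilon> powr p * geometric_const p"
    proof (cases K)
      case (Suc n)
      define b where "b = \<epsilon>0 / 2 ^ n"
      have b: "\<epsilon> < b" using active[of n] Suc by (simp add: b_def)
      \<comment> \<open>Count the stages from the last one, whose starting gap is \<open>b\<close>.\<close>
      have "(\<Sum>j<K. (\<epsilon>0 / 2 ^ j) powr p) = (\<Sum>j<K. (b * 2 ^ j) powr p)"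
      proof (rule sum.reindex_bij_witness[of _ "\<lambda>j. n - j" "\<lambda>j. n - j"])
        fix j assume "j \<in> {..<K}"
        then have "j \<le> n" using Suc by simp
        then show "(b * 2 ^ (n - j)) powr p = (\<epsilon>0 / 2 ^ j) powr p"
          by (simp add: b_def power_diff)
      qed (use Suc in auto)
      also have "\<dots> = b powr p * (\<Sum>j<K. (2 powr - (- p)) ^ j)"
        unfolding sum_distrib_left
      proof (rule sum.cong)
        fix j
        have "(2 ^ j) powr p = (2 powr p) ^ j"
          by (simp add: powr_powr powr_realpow[symmetric] mult.commute)
        then show "(b * 2 ^ j) powr p = b powr p * (2 powr - (- p)) ^ j"
          using b \<epsilon> by (simp add: powr_mult)
      qed simp
      also have "\<dots> \<le> b powr p * geometric_const (- p)"
        using 3 by (intro mult_left_mono sum_powr_le_geometric_const) auto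
      also have "\<dots> \<le> \<epsilon> powr p * geometric_const (- p)"
        using 3 b \<epsilon> geometric_const_ge_1[of "- p"] by (intro mult_right_mono powr_mono2') auto
      also have "geometric_const (- p) = geometric_const p" by (simp add: geometric_const_def)
      finally show ?thesis .
    qed (use geometric_const_ge_1[of p] in simp)
    then have "A * (\<Sum>j<K. (\<epsilon>0 / 2 ^ j) powr p) \<le> A * (\<epsilon> powr p * geometric_const p)"
      using A by (intro mult_left_mono) auto
    also have "\<dots> = geometric_const p * (A / \<epsilon> powr (- p))"
      using \<epsilon> by (simp add: powr_minus divide_inverse)
    also have "\<dots> \<le> geometric_const p * pg_bound \<theta> c L \<epsilon>0 \<epsilon>"
      using 3 A geometric_const_ge_1[of p]
      by (intro mult_left_mono) (auto simp: pg_bound_def p_def)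
    finally show "(\<Sum>j<K. A * (\<epsilon>0 / 2 ^ j) powr p) \<le> geometric_const p * pg_bound \<theta> c L \<epsilon>0 \<epsilon>"
      by (simp add: sum_distrib_left)
  qed
qed

lemma exists_stage_count:
  fixes \<epsilon> \<epsilon>0 :: real
  assumes "0 < \<epsilon>"
  shows "\<exists>K. \<epsilon>0 / 2 ^ K \<le> \<epsilon> \<and> (\<forall>j<K. \<epsilon> < \<epsilon>0 / 2 ^ j)"
proof -
  obtain n where "\<epsilon>0 / \<epsilon> < 2 ^ n" using real_arch_pow[of 2 "\<epsilon>0 / \<epsilon>"] by auto
  then have ex: "\<epsilon>0 / 2 ^ n \<le> \<epsilon>" using assms by (simp add: field_simps)
  show ?thesis
    using exists_least_iff[of "\<lambda>K. \<epsilon>0 / 2 ^ K \<le> \<epsilon>"] ex by (meson not_le)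
qed

text \<open>
  Rounding up costs at most one iteration per stage.  If no stage costs less than one iteration, it at
  most doubles the total.  As the cost of a stage is monotone in its gap, it is enough to know this at the
  two ends \<open>\<epsilon>\<^sub>0\<close> and \<open>\<epsilon>\<close>.
\<close>

lemma sum_stage_costs_ceiling_le:
  fixes A c L \<epsilon> \<epsilon>0 \<theta> :: real and K :: nat
  assumes A: "A = c\<^sup>2 * L" "0 < A" and \<epsilon>: "0 < \<epsilon>" "\<epsilon> < \<epsilon>0"
    and active: "\<And>j. j < K \<Longrightarrow> \<epsilon> < \<epsilon>0 / 2 ^ j"
  defines "N \<equiv> (\<Sum>j<K. \<lceil>A * (\<epsilon>0 / 2 ^ j) powr (2 * \<theta> - 1)\<rceil>)"
  shows "real_of_int N \<le> geometric_const (2 * \<theta> - 1) * pg_bound \<theta> c L \<epsilon>0 \<epsilon> + (1 + 2 * ln (\<epsilon>0 / \<epsilon>))"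
    and "ceilings_negligible \<theta> c L \<epsilon>0 \<epsilon> \<Longrightarrow>
      real_of_int N \<le> 2 * (geometric_const (2 * \<theta> - 1) * pg_bound \<theta> c L \<epsilon>0 \<epsilon>)"
proof -
  let ?a = "\<lambda>j. A * (\<epsilon>0 / 2 ^ j) powr (2 * \<theta> - 1)"
  have sum: "(\<Sum>j<K. ?a j) \<le> geometric_const (2 * \<theta> - 1) * pg_bound \<theta> c L \<epsilon>0 \<epsilon>"
    by (rule sum_stage_costs_le) (use assms in auto)
  have stages: "real K \<le> 1 + 2 * ln (\<epsilon>0 / \<epsilon>)"
    by (rule number_of_stages) (use assms in auto)
  have "real_of_int N \<le> (\<Sum>j<K. ?a j + 1)"
    unfolding N_def of_int_sum by (intro sum_mono of_int_ceiling_le_add_one)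
  also have "\<dots> = (\<Sum>j<K. ?a j) + real K" by (simp add: sum.distrib)
  finally show "real_of_int N \<le> geometric_const (2 * \<theta> - 1) * pg_bound \<theta> c L \<epsilon>0 \<epsilon> + (1 + 2 * ln (\<epsilon>0 / \<epsilon>))"
    using sum stages by linarith
  assume "ceilings_negligible \<theta> c L \<epsilon>0 \<epsilon>"
  then have ends: "1 \<le> A * \<epsilon>0 powr (2 * \<theta> - 1)" "1 \<le> A * \<epsilon> powr (2 * \<theta> - 1)"
    unfolding ceilings_negligible_def A(1) by auto
  have ge_1: "1 \<le> ?a j" if "j < K" for j
  proof (cases "0 \<le> 2 * \<theta> - 1")
    case True
    have "\<epsilon> powr (2 * \<theta> - 1) \<le> (\<epsilon>0 / 2 ^ j) powr (2 * \<theta> - 1)"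
      using True active[OF that] \<epsilon> by (intro powr_mono2) auto
    then have "A * \<epsilon> powr (2 * \<theta> - 1) \<le> ?a j" using A by (intro mult_left_mono) auto
    then show ?thesis using ends by linarith
  next
    case False
    have "\<epsilon>0 / 2 ^ j \<le> \<epsilon>0 / 1" using \<epsilon> by (intro divide_left_mono) auto
    then have "\<epsilon>0 powr (2 * \<theta> - 1) \<le> (\<epsilon>0 / 2 ^ j) powr (2 * \<theta> - 1)"
      using False \<epsilon> by (intro powr_mono2') auto
    then have "A * \<epsilon>0 powr (2 * \<theta> - 1) \<le> ?a j" using A by (intro mult_left_mono) auto
    then show ?thesis using ends by linarith
  qed
  have "real_of_int N \<le> (\<Sum>j<K. 2 * ?a j)"
    unfolding N_def of_int_sum
  proof (intro sum_mono)
    fix j assume "j \<in> {..<K}"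
    then have "1 \<le> ?a j" using ge_1 by simp
    then show "real_of_int \<lceil>?a j\<rceil> \<le> 2 * ?a j"
      using of_int_ceiling_le_add_one[of "?a j"] by linarith
  qed
  also have "\<dots> = 2 * (\<Sum>j<K. ?a j)" by (simp add: sum_distrib_left)
  finally show "real_of_int N \<le> 2 * (geometric_const (2 * \<theta> - 1) * pg_bound \<theta> c L \<epsilon>0 \<epsilon>)"
    using sum by linarith
qed

text \<open>
  With \<open>\<delta> t > 0\<close> each of the first \<open>t\<close> steps would lower \<open>\<delta>\<close> by \<open>q\<close>, \<open>q t > \<delta> 0\<close> in total.
\<close>

lemma fixed_decrease_terminates:
  fixes \<delta> :: "nat \<Rightarrow> real"
  assumes nonneg: "\<And>t. 0 \<le> \<delta> t" and anti: "\<And>t. \<delta> (Suc t) \<le> \<delta> t"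
    and dec: "\<And>t. 0 < \<delta> (Suc t) \<Longrightarrow> \<delta> (Suc t) + q \<le> \<delta> t"
    and t: "\<delta> 0 < q * real t"
  shows "\<delta> t = 0"
proof (rule ccontr)
  assume "\<delta> t \<noteq> 0"
  then have pos: "0 < \<delta> t" using nonneg[of t] by simp
  have "\<delta> s + q * real s \<le> \<delta> 0" if "s \<le> t" for s
    using that
  proof (induction s)
    case (Suc s)
    have "\<delta> t \<le> \<delta> (Suc s)" by (rule lift_Suc_antimono_le[of \<delta>, OF anti Suc.prems])
    then have "\<delta> (Suc s) + q \<le> \<delta> s" using pos by (intro dec) simp
    then show ?case using Suc by (simp add: algebra_simps)
  qed simp
  from this[of t] t pos show False by simp
qed

theorem theorem1:
  fixes \<theta> :: real
  assumes "0 < \<theta>" "\<theta> \<le> 1"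
  shows "\<exists>C>0. \<forall>(d::nat) (f :: (nat \<Rightarrow> real) \<Rightarrow> real) (g :: (nat \<Rightarrow> real) \<Rightarrow> ereal)
            (L::real) (c::real) (\<epsilon>0::real) (\<epsilon>::real) (x0 :: nat \<Rightarrow> real).
       convex_fun d (\<lambda>x. ereal (f x)) \<and> L_smooth d L f \<and>
       proper_fun d g \<and> lsc_fun d g \<and> convex_fun d g \<and>
       minimizers d (objective f g) \<noteq> {} \<and>
       x0 \<in> Rn d \<and> objective f g x0 - min_value d (objective f g) \<le> ereal \<epsilon>0 \<and>
       0 < c \<and> HEB d (objective f g) \<epsilon>0 \<theta> c \<and> 0 < \<epsilon> \<longrightarrow>
       (\<forall>t::nat.
          (ceilings_negligible \<theta> c L \<epsilon>0 \<epsilon> \<and> C * pg_bound \<theta> c L \<epsilon>0 \<epsilon> \<le> real t) \<or>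
          (\<theta> = 1 \<and> C * max 1 (pg_bound \<theta> c L \<epsilon>0 \<epsilon>) \<le> real t) \<or>
          C * (pg_bound \<theta> c L \<epsilon>0 \<epsilon> + (1 + ln (\<epsilon>0 / \<epsilon>))) \<le> real t \<longrightarrow>
          objective f g (pg d L f g x0 t) - min_value d (objective f g) \<le> ereal \<epsilon>)"
proof -
  let ?G = "geometric_const (2 * \<theta> - 1)"
  \<comment> \<open>The factor \<open>2 * ?G\<close> serves the two halving regimes; \<open>9\<close> serves \<open>\<theta> = 1\<close>,
    where \<open>8 c\<^sup>2 L \<epsilon>\<^sub>0\<close> iterations and one more are enough.\<close>
  define C where "C = 2 * ?G + 9"
  have G: "1 \<le> ?G" by (rule geometric_const_ge_1)
  have "0 < C" using G by (simp add: C_def)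
  show ?thesis
  proof (intro exI[of _ C] conjI allI impI, rule \<open>0 < C\<close>, elim conjE)
    fix d f g L c \<epsilon>0 \<epsilon> x0 t
    let ?F = "objective f g" and ?B = "pg_bound \<theta> c L \<epsilon>0 \<epsilon>" and ?l = "ln (\<epsilon>0 / \<epsilon>)"
    assume prob: "convex_fun d (\<lambda>x. ereal (f x))" "L_smooth d L f" "proper_fun d g" "lsc_fun d g"
        "convex_fun d g" "minimizers d ?F \<noteq> {}"
      and start: "x0 \<in> Rn d" "?F x0 - min_value d ?F \<le> ereal \<epsilon>0"
      and c: "0 < c" and heb: "HEB d ?F \<epsilon>0 \<theta> c" and \<epsilon>: "0 < \<epsilon>"
      and t: "(ceilings_negligible \<theta> c L \<epsilon>0 \<epsilon> \<and> C * ?B \<le> real t) \<or>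
          (\<theta> = 1 \<and> C * max 1 ?B \<le> real t) \<or> C * (?B + (1 + ?l)) \<le> real t"
    interpret composite_objective d f g L using prob by unfold_locales
    define \<delta> where "\<delta> t = gap (pg d L f g x0 t)" for t
    note run = start heb
    have anti: "\<delta> t \<le> \<delta> s" if "s \<le> t" for s t
      unfolding \<delta>_def by (rule gap_antimono[OF run that])
    have nonneg: "0 \<le> \<delta> t" for t
      unfolding \<delta>_def by (rule gap_nonneg[OF X_in_eff_dom[OF run]])
    have init: "\<delta> t \<le> \<epsilon>0" for t
      unfolding \<delta>_def by (rule gap_le_initial[OF run])
    define A where "A = c\<^sup>2 * L"
    have A: "0 < A" using c L_pos by (simp add: A_def)
    have "\<delta> t \<le> \<epsilon>"
    proof (cases "\<epsilon> < \<epsilon>0")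
      case False
      \<comment> \<open>The target is met from the start, as the gap never increases.\<close>
      then show ?thesis using init[of t] by simp
    next
      case True
      have l: "0 < ?l" using True \<epsilon> by simp
      have B: "0 \<le> ?B" using A \<epsilon> by (auto simp: pg_bound_def A_def[symmetric] le_max_iff_disj)
      obtain K where K: "\<epsilon>0 / 2 ^ K \<le> \<epsilon>" and active: "\<And>j. j < K \<Longrightarrow> \<epsilon> < \<epsilon>0 / 2 ^ j"
        using exists_stage_count[OF \<epsilon>, of \<epsilon>0] by blast
      define N where "N = (\<Sum>j<K. \<lceil>A * (\<epsilon>0 / 2 ^ j) powr (2 * \<theta> - 1)\<rceil>)"
      have N_le: "real_of_int N \<le> ?G * ?B + (1 + 2 * ?l)"
        unfolding N_def by (rule sum_stage_costs_ceiling_le(1)[OF A_def A \<epsilon> True active])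
      have N_le_negligible: "real_of_int N \<le> 2 * (?G * ?B)" if "ceilings_negligible \<theta> c L \<epsilon>0 \<epsilon>"
        unfolding N_def using that by (rule sum_stage_costs_ceiling_le(2)[OF A_def A \<epsilon> True active, rotated])
      have enough: "\<delta> t \<le> \<epsilon>" if "real_of_int N \<le> real t"
      proof -
        have "\<delta> t \<le> \<epsilon>0 / 2 ^ K"
        proof (rule halving_stages[where A = A and \<theta> = \<theta>])
          show "2 * real k * \<delta> (s + k) \<le> A * \<delta> s powr (2 * \<theta>)" for s k
            unfolding \<delta>_def A_def by (rule gap_rate[OF run])
          show "(\<Sum>j<K. \<lceil>A * (\<epsilon>0 / 2 ^ j) powr (2 * \<theta> - 1)\<rceil>) \<le> int t"
            using that unfolding N_def by linarith
        qed (use anti nonneg init A assms \<epsilon> True in auto)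
        then show ?thesis using K by linarith
      qed
      from t show ?thesis
      proof (elim disjE conjE)
        assume "ceilings_negligible \<theta> c L \<epsilon>0 \<epsilon>" "C * ?B \<le> real t"
        moreover have "C * ?B = 2 * (?G * ?B) + 9 * ?B" by (simp add: C_def algebra_simps)
        ultimately show ?thesis using N_le_negligible B by (intro enough) linarith
      next
        assume "C * (?B + (1 + ?l)) \<le> real t"
        moreover have "?G * ?B \<le> C * ?B" using G B by (intro mult_right_mono) (auto simp: C_def)
        moreover have "2 * (1 + ?l) \<le> C * (1 + ?l)" using G l by (intro mult_right_mono) (auto simp: C_def)
        ultimately have "?G * ?B + (1 + 2 * ?l) \<le> real t" by (simp add: distrib_left)
        then show ?thesis using N_le by (intro enough) simp
      next
        assume \<theta>: "\<theta> = 1" and t: "C * max 1 ?B \<le> real t"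
        have BA: "?B = A * \<epsilon>0"
          using \<theta> \<epsilon> True by (simp add: pg_bound_def A_def)
        have "9 * max 1 ?B \<le> C * max 1 ?B" using G by (intro mult_right_mono) (auto simp: C_def)
        then have "8 * (A * \<epsilon>0) < real t" using t BA by linarith
        moreover have "8 * (A * \<delta> 0) \<le> 8 * (A * \<epsilon>0)" using init[of 0] A by simp
        ultimately have "8 * (A * \<delta> 0) < real t" by linarith
        then have "\<delta> 0 < 1 / (8 * A) * real t"
          using A by (simp add: field_simps)
        have "\<delta> t = 0"
        proof (rule fixed_decrease_terminates)
          show "\<delta> (Suc t) + 1 / (8 * A) \<le> \<delta> t" if "0 < \<delta> (Suc t)" for t
            using that sharp_gap_decrease[OF run c \<theta>] unfolding \<delta>_def A_def by blast
        qed (use nonneg anti \<open>\<delta> 0 < _\<close> in auto)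
        then show ?thesis using \<epsilon> by simp
      qed
    qed
    then show "?F (pg d L f g x0 t) - min_value d ?F \<le> ereal \<epsilon>"
      using objective_gap_X[OF run, of t] by (simp add: \<delta>_def)
  qed
qed

end
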